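(* Let $V$ be a finite-dimensional complex vector space and let $T:V\to V$ be a nilpotent linear operator. Then the Jordan bases of $T$ are exactly the orbits of minimum-weight $q$-bases; that is, a subset $J\subseteq V$ is a Jordan basis of $T$ if and only if $J$ is the orbit of some $q$-basis of minimum weight.
   Context: Let $q:V\to V/\operatorname{Im}(T)$ be the canonical projection. A $q$-basis is a subset $B\subseteq V$ that $q$ maps (bijectively) onto a basis of $V/\operatorname{Im}(T)$. For $v\in V$ let $\mathbf K(v)$ be the least nonnegative integer $m$ with $T^m v=0$, so that $\ker(T^m)=\{v:\mathbf K(v)\le m\}$ for all $m\ge 0$. The weight of a finite set $B\subseteq V$ is $\sum_{b\in B}\mathbf K(b)$; a $q$-basis has minimum weight if its weight is minimal among all $q$-bases. The orbit of a subset $B\subseteq V$ is the set of all nonzero vectors of the form $T^m b$ with $b\in B$, $m\ge 0$. A Jordan basis of $T$ is a basis of $V$ that is a disjoint union of orbits of single vectors, i.e. of sets $\{v,Tv,\dots,T^{k}v\}$ with $T^k v\neq 0$ and $T^{k+1}v=0$. *)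

theory Defs
  imports Complex_Main "HOL-Library.Set_Algebras" "HOL-Library.Disjoint_Sets"
begin

definition is_basis :: "('k::field \<Rightarrow> 'v::ab_group_add \<Rightarrow> 'v) \<Rightarrow> 'v set \<Rightarrow> bool" where
  "is_basis scale B \<longleftrightarrow> \<not> module.dependent scale B \<and> module.span scale B = UNIV"

definition nilpotent_map :: "('v::zero \<Rightarrow> 'v) \<Rightarrow> bool" where
  "nilpotent_map T \<longleftrightarrow> (\<exists>n. \<forall>v. (T ^^ n) v = 0)"


text \<open>
  The quotient of the space by a subspace \<open>W\<close>. Its vectors are the cosets \<open>v +o W\<close>, its zero
  vector is \<open>W\<close>, and its addition is the elementwise sum of sets. The elementwise multiple of a
  coset by \<open>0\<close> is \<open>{0}\<close> rather than \<open>W\<close>, and a sum of sets over an empty index set is \<open>{0}\<close>;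
  adding \<open>W\<close> turns both into the zero vector \<open>W\<close> and changes no other coset. The notions of
  linear independence and span repeat the library definitions with these operations
  (a basis of the quotient cannot use the library notion directly, because the cosets of a
  given subspace do not form a type).
\<close>

definition quot_proj :: "'v::ab_group_add set \<Rightarrow> 'v \<Rightarrow> 'v set" where
  "quot_proj W v = v +o W"

definition quot_scale ::
  "('k \<Rightarrow> 'v \<Rightarrow> 'v) \<Rightarrow> 'v::ab_group_add set \<Rightarrow> 'k \<Rightarrow> 'v set \<Rightarrow> 'v set" where
  "quot_scale scale W c A = scale c ` A + W"

definition quot_lincomb ::
  "('k \<Rightarrow> 'v \<Rightarrow> 'v) \<Rightarrow> 'v::ab_group_add set \<Rightarrow> ('v set \<Rightarrow> 'k) \<Rightarrow> 'v set set \<Rightarrow> 'v set" where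
  "quot_lincomb scale W u t = W + (\<Sum>A\<in>t. quot_scale scale W (u A) A)"

definition quot_dependent ::
  "('k::field \<Rightarrow> 'v \<Rightarrow> 'v) \<Rightarrow> 'v::ab_group_add set \<Rightarrow> 'v set set \<Rightarrow> bool" where
  "quot_dependent scale W S \<longleftrightarrow>
     (\<exists>t u. finite t \<and> t \<subseteq> S \<and> quot_lincomb scale W u t = W \<and> (\<exists>A\<in>t. u A \<noteq> 0))"

definition quot_span ::
  "('k \<Rightarrow> 'v \<Rightarrow> 'v) \<Rightarrow> 'v::ab_group_add set \<Rightarrow> 'v set set \<Rightarrow> 'v set set" where
  "quot_span scale W S = {quot_lincomb scale W u t | t u. finite t \<and> t \<subseteq> S}"

definition is_quot_basis ::
  "('k::field \<Rightarrow> 'v \<Rightarrow> 'v) \<Rightarrow> 'v::ab_group_add set \<Rightarrow> 'v set set \<Rightarrow> bool" where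
  "is_quot_basis scale W S \<longleftrightarrow>
     S \<subseteq> range (quot_proj W) \<and> \<not> quot_dependent scale W S \<and>
     quot_span scale W S = range (quot_proj W)"

context vector_space
begin

lemma subspace_plus_self: "subspace W \<Longrightarrow> W + W = W"
  by (force simp: set_plus_def intro: subspace_add subspace_0)

lemma quot_proj_0: "quot_proj W 0 = W"
  by (simp add: quot_proj_def)

lemma quot_proj_add:
  "subspace W \<Longrightarrow> quot_proj W (v + w) = quot_proj W v + quot_proj W w"
  by (simp add: quot_proj_def set_plus_rearrange subspace_plus_self)

lemma quot_proj_scale:
  assumes W: "subspace W"
  shows "quot_proj W (c *s v) = quot_scale scale W c (quot_proj W v)"
proof
  show "quot_proj W (c *s v) \<subseteq> quot_scale scale W c (quot_proj W v)"
  proof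
    fix x assume "x \<in> quot_proj W (c *s v)"
    then obtain w where "w \<in> W" "x = c *s v + w"
      by (auto simp: quot_proj_def elt_set_plus_def)
    moreover have "v \<in> quot_proj W v"
      using subspace_0[OF W] by (force simp: quot_proj_def elt_set_plus_def)
    ultimately show "x \<in> quot_scale scale W c (quot_proj W v)"
      by (auto simp: quot_scale_def)
  qed
  show "quot_scale scale W c (quot_proj W v) \<subseteq> quot_proj W (c *s v)"
    using W by (auto simp: quot_scale_def quot_proj_def elt_set_plus_def set_plus_def
        scale_right_distrib add.assoc intro!: subspace_add subspace_scale)
qed

lemma quot_proj_eq_iff:
  assumes W: "subspace W"
  shows "quot_proj W v = quot_proj W w \<longleftrightarrow> v - w \<in> W"
proof
  assume "quot_proj W v = quot_proj W w"
  moreover have "v \<in> quot_proj W v"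
    using subspace_0[OF W] by (force simp: quot_proj_def elt_set_plus_def)
  ultimately show "v - w \<in> W"
    by (auto simp: quot_proj_def elt_set_plus_def)
next
  assume a: "v - w \<in> W"
  have "quot_proj W v = quot_proj W w + quot_proj W (v - w)"
    using quot_proj_add[OF W, of w "v - w"] by simp
  also have "quot_proj W (v - w) = W"
  proof
    show "quot_proj W (v - w) \<subseteq> W"
      using W a by (auto simp: quot_proj_def elt_set_plus_def intro: subspace_add)
    show "W \<subseteq> quot_proj W (v - w)"
    proof
      fix x assume "x \<in> W"
      then have "x - (v - w) \<in> W" by (rule subspace_diff[OF W _ a])
      then show "x \<in> quot_proj W (v - w)"
        unfolding quot_proj_def elt_set_plus_def by force
    qed
  qed
  also have "quot_proj W w + W = quot_proj W w"
    using quot_proj_add[OF W, of w 0] by (simp add: quot_proj_0)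
  finally show "quot_proj W v = quot_proj W w" .
qed

lemma quot_lincomb_image:
  assumes W: "subspace W" and t: "finite t" "inj_on (quot_proj W) t"
  shows "quot_lincomb scale W u (quot_proj W ` t) =
    quot_proj W (\<Sum>v\<in>t. u (quot_proj W v) *s v)"
  using t
proof (induction t rule: finite_induct)
  case empty
  then show ?case by (simp add: quot_lincomb_def quot_proj_0)
next
  case (insert v t)
  have "quot_proj W v \<notin> quot_proj W ` t"
    using insert.prems insert.hyps by auto
  then have "quot_lincomb scale W u (quot_proj W ` insert v t) =
      quot_scale scale W (u (quot_proj W v)) (quot_proj W v) +
      quot_lincomb scale W u (quot_proj W ` t)"
    using insert.hyps by (simp add: quot_lincomb_def ac_simps)
  then show ?case
    using insert by (simp add: quot_proj_scale[OF W] quot_proj_add[OF W])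
qed

end


definition is_q_basis ::
  "('k::field \<Rightarrow> 'v \<Rightarrow> 'v) \<Rightarrow> ('v \<Rightarrow> 'v) \<Rightarrow> 'v::ab_group_add set \<Rightarrow> bool" where
  "is_q_basis scale T B \<longleftrightarrow>
     (\<exists>C. is_quot_basis scale (range T) C \<and> bij_betw (quot_proj (range T)) B C)"

definition nil_height :: "('v::zero \<Rightarrow> 'v) \<Rightarrow> 'v \<Rightarrow> nat" where
  "nil_height T v = (LEAST m. (T ^^ m) v = 0)"

definition weight :: "('v::zero \<Rightarrow> 'v) \<Rightarrow> 'v set \<Rightarrow> nat" where
  "weight T B = (\<Sum>b\<in>B. nil_height T b)"

text \<open>
  In a finite-dimensional space every q-basis is finite, so \<^term>\<open>weight T B\<close> is a genuine sum
  for all sets compared here.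
\<close>

definition is_min_weight_q_basis ::
  "('k::field \<Rightarrow> 'v \<Rightarrow> 'v) \<Rightarrow> ('v \<Rightarrow> 'v) \<Rightarrow> 'v::ab_group_add set \<Rightarrow> bool" where
  "is_min_weight_q_basis scale T B \<longleftrightarrow>
     is_q_basis scale T B \<and> (\<forall>B'. is_q_basis scale T B' \<longrightarrow> weight T B \<le> weight T B')"

definition orbit :: "('v::zero \<Rightarrow> 'v) \<Rightarrow> 'v set \<Rightarrow> 'v set" where
  "orbit T B = {(T ^^ m) b | m b. b \<in> B \<and> (T ^^ m) b \<noteq> 0}"

definition is_chain :: "('v::zero \<Rightarrow> 'v) \<Rightarrow> 'v set \<Rightarrow> bool" where
  "is_chain T C \<longleftrightarrow>
     (\<exists>v k. C = {(T ^^ i) v | i. i \<le> k} \<and> (T ^^ k) v \<noteq> 0 \<and> (T ^^ Suc k) v = 0)"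

lemma is_chain_iff_orbit:
  assumes T0: "T 0 = 0" and T: "nilpotent_map T"
  shows "is_chain T C \<longleftrightarrow> (\<exists>v. v \<noteq> 0 \<and> C = orbit T {v})"
proof -
  have zero: "(T ^^ m) 0 = 0" for m
    by (induction m) (simp_all add: T0)
  have mono: "(T ^^ j) v = 0" if "(T ^^ i) v = 0" "i \<le> j" for i j v
    using that zero by (metis funpow_add le_add_diff_inverse2 o_apply)
  have eq: "{(T ^^ i) v | i. i \<le> k} = orbit T {v}"
    if "(T ^^ k) v \<noteq> 0" "(T ^^ Suc k) v = 0" for v k
  proof -
    have "i \<le> k \<longleftrightarrow> (T ^^ i) v \<noteq> 0" for i
      using that mono by (metis not_less_eq_eq)
    then show ?thesis by (auto simp: orbit_def)
  qed
  have ex: "\<exists>k. (T ^^ k) v \<noteq> 0 \<and> (T ^^ Suc k) v = 0" if "v \<noteq> 0" for v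
  proof -
    obtain n where "(T ^^ n) v = 0" using T by (auto simp: nilpotent_map_def)
    then have "\<exists>k<n. (\<forall>i\<le>k. (T ^^ i) v \<noteq> 0) \<and> (T ^^ Suc k) v = 0"
      using ex_least_nat_less[of "\<lambda>m. (T ^^ m) v = 0" n] that by auto
    then show ?thesis by blast
  qed
  show ?thesis
  proof
    assume "is_chain T C"
    then obtain v k where *: "C = {(T ^^ i) v | i. i \<le> k}" "(T ^^ k) v \<noteq> 0" "(T ^^ Suc k) v = 0"
      by (auto simp: is_chain_def)
    then have "v \<noteq> 0" using zero by auto
    with * eq show "\<exists>v. v \<noteq> 0 \<and> C = orbit T {v}" by blast
  next
    assume "\<exists>v. v \<noteq> 0 \<and> C = orbit T {v}"
    then obtain v where "v \<noteq> 0" and C: "C = orbit T {v}" by blast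
    with ex obtain k where k: "(T ^^ k) v \<noteq> 0" "(T ^^ Suc k) v = 0" by blast
    show "is_chain T C"
      unfolding is_chain_def C eq[OF k, symmetric] using k by blast
  qed
qed

definition is_jordan_basis ::
  "('k::field \<Rightarrow> 'v \<Rightarrow> 'v) \<Rightarrow> ('v \<Rightarrow> 'v) \<Rightarrow> 'v::ab_group_add set \<Rightarrow> bool" where
  "is_jordan_basis scale T J \<longleftrightarrow>
     is_basis scale J \<and> (\<exists>\<C>. (\<forall>C\<in>\<C>. is_chain T C) \<and> disjoint \<C> \<and> J = \<Union>\<C>)"

end

theory Submission
  imports Defs
begin

text \<open>
  If \<open>B\<close> spans \<open>V\<close> modulo \<open>range T\<close>, then by nilpotency the vectors \<open>T^m b\<close> span \<open>V\<close>, so the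
  weight of \<open>B\<close>, which counts the pairs \<open>(b, m)\<close> with \<open>T^m b \<noteq> 0\<close>, is at least \<open>dim V\<close>. A Jordan
  basis is the orbit of the set of its chain heads, and that set is a q-basis attaining this bound.
  Conversely, let \<open>\<Sum> c (b, m) T^m b = 0\<close> be a nontrivial relation along the orbit of a q-basis,
  \<open>m\<^sub>0\<close> the least exponent occurring in it, and \<open>c (b\<^sub>0, m\<^sub>0) \<noteq> 0\<close>. The relation reads
  \<open>T^m\<^sub>0 x = 0\<close> with \<open>x \<in> c (b\<^sub>0, m\<^sub>0) b\<^sub>0 + span (B - {b\<^sub>0}) + range T\<close>, and exchanging \<open>b\<^sub>0\<close> for \<open>x\<close>
  gives a q-basis of smaller weight. Hence the orbit of a q-basis of minimum weight is independent.
\<close>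

section \<open>Bases of a quotient, expressed in the ambient space\<close>

context vector_space
begin

text \<open>A relation between cosets is a combination of representatives whose value lies in
  \<open>W\<close>. Dividing by a nonzero coefficient then puts one representative in the span of
  the others and \<open>W\<close>. Injectivity of \<open>quot_proj W\<close> on \<open>B\<close>
  lets coefficients move between cosets and representatives.\<close>

lemma quot_independent_iff:
  assumes W: "subspace W" and inj: "inj_on (quot_proj W) B"
  shows "\<not> quot_dependent scale W (quot_proj W ` B) \<longleftrightarrow> (\<forall>b\<in>B. b \<notin> span ((B - {b}) \<union> W))"
proof -
  let ?q = "quot_proj W"
  have lincomb: "quot_lincomb scale W u (?q ` t) = W \<longleftrightarrow> (\<Sum>v\<in>t. u (?q v) *s v) \<in> W"
    if "finite t" "t \<subseteq> B" for t u
    using quot_lincomb_image[OF W that(1) inj_on_subset[OF inj that(2)], of u]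
      quot_proj_eq_iff[OF W, of "\<Sum>v\<in>t. u (?q v) *s v" 0]
    by (simp add: quot_proj_0)
  show ?thesis
  proof
    assume indep: "\<not> quot_dependent scale W (?q ` B)"
    show "\<forall>b\<in>B. b \<notin> span ((B - {b}) \<union> W)"
    proof (intro ballI notI)
      fix b assume b: "b \<in> B" "b \<in> span ((B - {b}) \<union> W)"
      then obtain y w where y: "y \<in> span (B - {b})" and w: "w \<in> W" and byw: "b = y + w"
        using W by (auto simp: span_Un span_eq_iff[THEN iffD2])
      obtain t r where t: "finite t" "t \<subseteq> B - {b}" and yt: "y = (\<Sum>a\<in>t. r a *s a)"
        using y by (auto simp: span_explicit)
      \<comment> \<open>Coefficients have to be indexed by cosets, so those of \<open>b - y\<close>
        are carried over along the inverse of the projection. The value 1 at the coset of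
        \<open>b\<close> makes the relation nontrivial.\<close>
      define u where "u = (\<lambda>A. if A = ?q b then 1 else - r (inv_into B ?q A))"
      have u: "u (?q a) = - r a" if "a \<in> t" for a
      proof -
        have "a \<in> B" "a \<noteq> b" using that t by auto
        then show ?thesis
          using inj b(1) by (auto simp: u_def inv_into_f_f dest: inj_onD)
      qed
      have "(\<Sum>v\<in>insert b t. u (?q v) *s v) = b - y"
        using t u by (subst sum.insert) (auto simp: u_def yt sum_negf)
      also have "\<dots> \<in> W" using w byw by simp
      finally have "quot_lincomb scale W u (?q ` insert b t) = W"
        using lincomb[of "insert b t" u] t b by auto
      moreover have "u (?q b) \<noteq> 0" by (simp add: u_def)
      moreover have "finite (?q ` insert b t)" "?q ` insert b t \<subseteq> ?q ` B"
        using t b(1) by auto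
      ultimately show False
        using indep unfolding quot_dependent_def by blast
    qed
  next
    assume indep: "\<forall>b\<in>B. b \<notin> span ((B - {b}) \<union> W)"
    show "\<not> quot_dependent scale W (?q ` B)"
    proof
      assume "quot_dependent scale W (?q ` B)"
      then obtain t' u where t': "finite t'" "t' \<subseteq> ?q ` B"
        and 0: "quot_lincomb scale W u t' = W" and nz: "\<exists>A\<in>t'. u A \<noteq> 0"
        unfolding quot_dependent_def by blast
      obtain t where t: "t \<subseteq> B" "finite t" "t' = ?q ` t"
        using finite_subset_image[OF t'] by blast
      obtain b where b: "b \<in> t" "u (?q b) \<noteq> 0" using nz t by auto
      let ?S = "span ((B - {b}) \<union> W)"
      have "(\<Sum>v\<in>t. u (?q v) *s v) \<in> ?S"
        using lincomb[OF t(2,1), of u] 0 t by (auto intro: span_base)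
      moreover have "(\<Sum>v\<in>t - {b}. u (?q v) *s v) \<in> ?S"
        by (rule span_sum, rule span_scale, rule span_base) (use t in auto)
      ultimately have "(\<Sum>v\<in>t. u (?q v) *s v) - (\<Sum>v\<in>t - {b}. u (?q v) *s v) \<in> ?S"
        by (rule span_diff)
      then have "u (?q b) *s b \<in> ?S"
        using t b by (simp add: sum.remove)
      then have "inverse (u (?q b)) *s (u (?q b) *s b) \<in> ?S"
        by (rule span_scale)
      then show False using b t indep by auto
    qed
  qed
qed

text \<open>The span of the cosets is the image of \<open>span B\<close>, and this image is the
  whole quotient exactly when every vector is a sum of one from \<open>span B\<close> and one from
  \<open>W\<close>.\<close>

lemma quot_span_eq_iff:
  assumes W: "subspace W" and inj: "inj_on (quot_proj W) B"
  shows "quot_span scale W (quot_proj W ` B) = range (quot_proj W) \<longleftrightarrow> span (B \<union> W) = UNIV"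
proof -
  let ?q = "quot_proj W"
  have "quot_span scale W (?q ` B) = ?q ` span B"
  proof (intro equalityI subsetI)
    fix A assume "A \<in> quot_span scale W (?q ` B)"
    then obtain t' u where t': "finite t'" "t' \<subseteq> ?q ` B" and A: "A = quot_lincomb scale W u t'"
      unfolding quot_span_def by blast
    obtain t where t: "t \<subseteq> B" "finite t" "t' = ?q ` t"
      using finite_subset_image[OF t'] by blast
    have "A = ?q (\<Sum>v\<in>t. u (?q v) *s v)"
      using quot_lincomb_image[OF W t(2) inj_on_subset[OF inj t(1)]] t(3) A by simp
    moreover have "(\<Sum>v\<in>t. u (?q v) *s v) \<in> span B"
      by (rule span_sum, rule span_scale, rule span_base) (use t in auto)
    ultimately show "A \<in> ?q ` span B" by blast
  next
    fix A assume "A \<in> ?q ` span B"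
    then obtain t r where t: "finite t" "t \<subseteq> B" and A: "A = ?q (\<Sum>v\<in>t. r v *s v)"
      by (auto simp: span_explicit)
    define u where "u = (\<lambda>A. r (inv_into B ?q A))"
    have "(\<Sum>v\<in>t. u (?q v) *s v) = (\<Sum>v\<in>t. r v *s v)"
      using t inj by (intro sum.cong) (auto simp: u_def inv_into_f_f)
    then have "A = quot_lincomb scale W u (?q ` t)"
      using quot_lincomb_image[OF W t(1) inj_on_subset[OF inj t(2)]] A by simp
    then show "A \<in> quot_span scale W (?q ` B)"
      using t unfolding quot_span_def by blast
  qed
  moreover have "?q ` span B = range ?q \<longleftrightarrow> span (B \<union> W) = UNIV"
  proof
    assume L: "?q ` span B = range ?q"
    have "v \<in> span (B \<union> W)" for v
    proof -
      have "?q v \<in> ?q ` span B" using L by simp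
      then obtain x where "x \<in> span B" "v - x \<in> W"
        using quot_proj_eq_iff[OF W] by blast
      then have "x + (v - x) \<in> span (B \<union> W)"
        by (meson span_add span_base span_mono UnI2 Un_upper1 subsetD)
      then show ?thesis by simp
    qed
    then show "span (B \<union> W) = UNIV" by blast
  next
    assume R: "span (B \<union> W) = UNIV"
    have "?q v \<in> ?q ` span B" for v
    proof -
      have "v \<in> span (B \<union> W)" using R by simp
      then obtain x w where "x \<in> span B" "w \<in> W" "v = x + w"
        using W by (auto simp: span_Un span_eq_iff[THEN iffD2])
      then show ?thesis using quot_proj_eq_iff[OF W, of v x] by auto
    qed
    then show "?q ` span B = range ?q" by blast
  qed
  ultimately show ?thesis by simp
qed

text \<open>Removes cosets from the rest of the proof. The independence condition on the right
  already forces injectivity of the projection: distinct \<open>b\<close> and \<open>c\<close> in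
  one coset would give \<open>b = c + (b - c)\<close>, a dependence of \<open>b\<close> on
  \<open>c\<close> and \<open>W\<close>.\<close>

lemma quot_basis_lift_iff:
  assumes W: "subspace W"
  shows "(\<exists>C. is_quot_basis scale W C \<and> bij_betw (quot_proj W) B C) \<longleftrightarrow>
    (\<forall>b\<in>B. b \<notin> span ((B - {b}) \<union> W)) \<and> span (B \<union> W) = UNIV"
    (is "?L \<longleftrightarrow> ?indep \<and> ?span")
proof
  assume ?L
  then have "is_quot_basis scale W (quot_proj W ` B)" "inj_on (quot_proj W) B"
    by (auto simp: bij_betw_def)
  then show "?indep \<and> ?span"
    using quot_independent_iff[OF W] quot_span_eq_iff[OF W] by (simp add: is_quot_basis_def)
next
  assume R: "?indep \<and> ?span"
  have inj: "inj_on (quot_proj W) B"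
  proof (rule inj_onI, rule ccontr)
    fix b c assume *: "b \<in> B" "c \<in> B" "quot_proj W b = quot_proj W c" "b \<noteq> c"
    then have "b - c \<in> W" using quot_proj_eq_iff[OF W] by blast
    then have "c + (b - c) \<in> span ((B - {b}) \<union> W)"
      using * by (intro span_add span_base) auto
    then show False using R * by simp
  qed
  with R have "is_quot_basis scale W (quot_proj W ` B)"
    using quot_independent_iff[OF W inj] quot_span_eq_iff[OF W inj] by (auto simp: is_quot_basis_def)
  with inj show ?L by (auto simp: bij_betw_def)
qed

text \<open>In an indexed family a repeated vector is itself a dependence, with coefficients 1 and
  -1. One hypothesis thus excludes both repetitions and relations between distinct vectors.\<close>

lemma independent_family_imp_inj_independent:
  assumes P: "finite P"
    and indep: "\<And>c. (\<Sum>p\<in>P. c p *s e p) = 0 \<Longrightarrow> \<forall>p\<in>P. c p = 0"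
  shows "inj_on e P" and "independent (e ` P)"
proof -
  show inj: "inj_on e P"
  proof (rule inj_onI, rule ccontr)
    fix p p' assume *: "p \<in> P" "p' \<in> P" "e p = e p'" "p \<noteq> p'"
    let ?c = "(\<lambda>r. if r = p then 1 else if r = p' then - 1 else 0)"
    have "(\<Sum>r\<in>P. ?c r *s e r) = (\<Sum>r\<in>{p, p'}. ?c r *s e r)"
      using * P by (intro sum.mono_neutral_right) auto
    also have "\<dots> = 0" using * by simp
    finally show False using indep[of ?c] * by auto
  qed
  show "independent (e ` P)"
    unfolding dependent_finite[OF finite_imageI[OF P]]
  proof clarify
    fix u p assume "(\<Sum>v\<in>e ` P. u v *s v) = 0" "p \<in> P" "u (e p) \<noteq> 0"
    then show False using indep[of "\<lambda>p. u (e p)"] by (simp add: sum.reindex[OF inj])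
  qed
qed

end

section \<open>Nilpotent operators and exchange in q-bases\<close>

locale nilpotent_operator = finite_dimensional_vector_space scale Basis
  for scale :: "'k::field \<Rightarrow> 'v::ab_group_add \<Rightarrow> 'v" (infixr "*s" 75) and Basis +
  fixes T :: "'v \<Rightarrow> 'v"
  assumes linear_T: "Vector_Spaces.linear scale scale T"
    and nilpotent_T: "nilpotent_map T"
begin

lemma linear_funpow: "Vector_Spaces.linear scale scale (T ^^ m)"
proof (induction m)
  case 0
  then show ?case using linear_id by (simp add: id_def)
next
  case (Suc m)
  then show ?case using Vector_Spaces.linear_compose[OF Suc linear_T] by (simp only: funpow.simps)
qed

lemmas funpow_T_0 [simp] = module_hom.zero[OF linear_funpow[unfolded linear_iff_module_hom]]

lemma T_0 [simp]: "T 0 = 0"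
  using funpow_T_0[of 1] by simp

lemma subspace_range_T: "subspace (range T)"
  using module_hom.subspace_image[OF linear_T[unfolded linear_iff_module_hom] subspace_UNIV] .

lemma is_q_basis_iff:
  "is_q_basis scale T B \<longleftrightarrow>
    (\<forall>b\<in>B. b \<notin> span ((B - {b}) \<union> range T)) \<and> span (B \<union> range T) = UNIV"
  unfolding is_q_basis_def by (rule quot_basis_lift_iff[OF subspace_range_T])

text \<open>Steinitz exchange relative to \<open>range T\<close>: modulo the remaining vectors and
  \<open>range T\<close>, \<open>x\<close> is a nonzero multiple of \<open>b\<close>, so each of the
  two can be recovered from the other.\<close>

lemma is_q_basis_exchange:
  assumes B: "is_q_basis scale T B" and b: "b \<in> B"
    and c: "c \<noteq> 0" and x: "x - c *s b \<in> span ((B - {b}) \<union> range T)"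
  shows "is_q_basis scale T (insert x (B - {b}))"
proof -
  let ?R = "(B - {b}) \<union> range T"
  have indep: "a \<notin> span ((B - {a}) \<union> range T)" if "a \<in> B" for a
    using B that by (auto simp: is_q_basis_iff)
  have x_notin: "x \<notin> span ?R"
  proof
    assume "x \<in> span ?R"
    then have "x - (x - c *s b) \<in> span ?R" using x by (rule span_diff)
    then have "c *s b \<in> span ?R" by simp
    then have "inverse c *s (c *s b) \<in> span ?R" by (rule span_scale)
    then show False using c indep[OF b] by simp
  qed
  have "x - c *s b \<in> span (insert b ?R)"
    using x span_mono[OF subset_insertI] by (rule subsetD[rotated])
  moreover have "c *s b \<in> span (insert b ?R)"
    by (rule span_scale, rule span_base) simp
  ultimately have "(x - c *s b) + c *s b \<in> span (insert b ?R)"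
    by (rule span_add)
  then have "b \<in> span (insert x ?R)"
    using x_notin by (simp add: in_span_insert)
  then have "B \<union> range T \<subseteq> span (insert x ?R)"
    by (auto intro: span_base)
  then have "span (B \<union> range T) \<subseteq> span (insert x ?R)"
    by (simp add: span_minimal)
  then have "span (insert x ?R) = UNIV" using B by (auto simp: is_q_basis_iff)
  moreover have "a \<notin> span ((insert x (B - {b}) - {a}) \<union> range T)" if "a \<in> insert x (B - {b})" for a
  proof (cases "a = x")
    case True
    have "(insert x (B - {b}) - {a}) \<union> range T \<subseteq> ?R" using True by auto
    then show ?thesis using x_notin True span_mono by blast
  next
    case False
    then have a: "a \<in> B" "a \<noteq> b" using that by auto
    let ?Q = "(B - {b} - {a}) \<union> range T"
    show ?thesis
    proof
      assume "a \<in> span ((insert x (B - {b}) - {a}) \<union> range T)"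
      also have "(insert x (B - {b}) - {a}) \<union> range T = insert x ?Q" using False by auto
      finally have "a \<in> span (insert x ?Q)" .
      moreover have "a \<notin> span ?Q"
      proof -
        have "?Q \<subseteq> (B - {a}) \<union> range T" by auto
        then show ?thesis using indep[OF a(1)] span_mono by blast
      qed
      \<comment> \<open>A dependence of \<open>a\<close> must involve \<open>x\<close>, since
        \<open>a\<close> is not in the span of \<open>?Q\<close>. Solving it for \<open>x\<close>
        contradicts \<open>x_notin\<close>.\<close>
      ultimately have "x \<in> span (insert a ?Q)" by (rule in_span_insert)
      moreover have "insert a ?Q = ?R" using a by auto
      ultimately show False using x_notin by simp
    qed
  qed
  ultimately show ?thesis by (simp add: is_q_basis_iff)
qed

lemma finite_q_basis:
  assumes "is_q_basis scale T B"
  shows "finite B"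
proof (rule finiteI_independent)
  show "independent B"
    unfolding dependent_def
  proof clarify
    fix b assume "b \<in> B" "b \<in> span (B - {b})"
    then show False
      using assms span_mono[of "B - {b}" "(B - {b}) \<union> range T"] by (auto simp: is_q_basis_iff)
  qed
qed

lemma zero_notin_q_basis: "is_q_basis scale T B \<Longrightarrow> 0 \<notin> B"
  using span_zero by (auto simp: is_q_basis_iff)

section \<open>Heights, orbits and the lower bound on the weight\<close>

lemma funpow_eq_0_iff: "(T ^^ m) v = 0 \<longleftrightarrow> nil_height T v \<le> m"
proof
  assume "(T ^^ m) v = 0"
  then show "nil_height T v \<le> m" unfolding nil_height_def by (rule Least_le)
next
  assume le: "nil_height T v \<le> m"
  obtain n where "(T ^^ n) v = 0" using nilpotent_T by (auto simp: nilpotent_map_def)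
  then have "(T ^^ nil_height T v) v = 0" unfolding nil_height_def by (rule LeastI)
  then have "(T ^^ (m - nil_height T v + nil_height T v)) v = 0"
    by (simp only: funpow_add o_apply funpow_T_0)
  then show "(T ^^ m) v = 0" using le by simp
qed

text \<open>A pair remembers which vector of \<open>B\<close> an orbit vector comes from. For finite
  \<open>B\<close> the pairs number exactly \<open>weight T B\<close>, whereas
  \<open>orbit T B\<close> is smaller if two pairs yield the same vector.\<close>

definition orbit_index :: "'v set \<Rightarrow> ('v \<times> nat) set" where
  "orbit_index B = (SIGMA b:B. {..<nil_height T b})"

definition orbit_vector :: "'v \<times> nat \<Rightarrow> 'v" where
  "orbit_vector = (\<lambda>(b, m). (T ^^ m) b)"

lemma mem_orbit_index: "(b, m) \<in> orbit_index B \<longleftrightarrow> b \<in> B \<and> (T ^^ m) b \<noteq> 0"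
  by (auto simp: orbit_index_def funpow_eq_0_iff)

lemma orbit_eq: "orbit T B = orbit_vector ` orbit_index B"
  by (force simp: orbit_def orbit_vector_def mem_orbit_index)

lemma finite_orbit_index: "finite B \<Longrightarrow> finite (orbit_index B)"
  by (simp add: orbit_index_def)

lemma card_orbit_index: "finite B \<Longrightarrow> card (orbit_index B) = weight T B"
  by (simp add: orbit_index_def weight_def)

text \<open>Substituting the decomposition of the space as \<open>span B\<close> plus
  \<open>range T\<close> into itself \<open>n\<close> times pushes the remainder into the range of
  \<open>T ^^ n\<close>, which is zero for large \<open>n\<close>.\<close>

lemma span_orbit:
  assumes B: "span (B \<union> range T) = UNIV"
  shows "span (orbit T B) = UNIV"
proof -
  have decomp: "\<exists>y\<in>span (orbit T B). \<exists>x. v = y + (T ^^ n) x" for v n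
  proof (induction n)
    case 0
    show ?case using span_zero by (metis add_0 funpow.simps(1) id_apply)
  next
    case (Suc n)
    then obtain y x where y: "y \<in> span (orbit T B)" and v: "v = y + (T ^^ n) x" by blast
    have "x \<in> span (B \<union> range T)" using B by simp
    then obtain s z where s: "s \<in> span B" and x: "x = s + T z"
      using subspace_range_T by (auto simp: span_Un span_eq_iff[THEN iffD2])
    have "(T ^^ n) ` span B = span ((T ^^ n) ` B)"
      using linear_funpow[of n] by (simp add: linear_iff_module_hom module_hom.span_image)
    \<comment> \<open>Where \<open>(T ^^ n) b\<close> is zero it is missing from the orbit, but zero
      lies in every span.\<close>
    moreover have "(T ^^ n) ` B \<subseteq> span (orbit T B)"
      by (auto simp: orbit_def) (metis (mono_tags, lifting) mem_Collect_eq span_base span_zero)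
    ultimately have "(T ^^ n) s \<in> span (orbit T B)"
      using s span_minimal[OF _ subspace_span] by blast
    then have "y + (T ^^ n) s \<in> span (orbit T B)" using y by (rule span_add[rotated])
    moreover have "v = (y + (T ^^ n) s) + (T ^^ Suc n) z"
      using linear_funpow[of n]
      by (simp add: v x linear_iff_module_hom module_hom.add funpow_swap1 add.assoc)
    ultimately show ?case by blast
  qed
  obtain n where "(T ^^ n) v = 0" for v using nilpotent_T by (auto simp: nilpotent_map_def)
  then show ?thesis using decomp[of _ n] by auto
qed

text \<open>Serves as the certificate of minimality: a q-basis whose weight equals the dimension has
  minimum weight.\<close>

lemma dim_le_weight:
  assumes B: "is_q_basis scale T B"
  shows "dim UNIV \<le> weight T B"
proof -
  have fin: "finite (orbit_index B)" using finite_orbit_index[OF finite_q_basis[OF B]] .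
  have "dim (UNIV :: 'v set) \<le> card (orbit T B)"
    using B fin span_orbit[of B] by (intro dim_le_card) (simp_all add: is_q_basis_iff orbit_eq)
  also have "\<dots> \<le> card (orbit_index B)"
    unfolding orbit_eq using fin by (rule card_image_le)
  finally show ?thesis using card_orbit_index[OF finite_q_basis[OF B]] by simp
qed

section \<open>From minimum weight to Jordan bases\<close>

lemma min_weight_orbit:
  assumes "is_min_weight_q_basis scale T B"
  shows "inj_on orbit_vector (orbit_index B)" and "independent (orbit T B)"
proof -
  let ?P = "orbit_index B"
  have B: "is_q_basis scale T B" using assms by (simp add: is_min_weight_q_basis_def)
  have fin: "finite B" "finite ?P" using finite_q_basis[OF B] finite_orbit_index by auto
  have indep: "\<forall>p\<in>?P. c p = 0" if rel: "(\<Sum>p\<in>?P. c p *s orbit_vector p) = 0" for c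
  proof (rule ccontr)
    assume "\<not> (\<forall>p\<in>?P. c p = 0)"
    then have ex: "\<exists>m b. (b, m) \<in> ?P \<and> c (b, m) \<noteq> 0" by force
    define m0 where "m0 = (LEAST m. \<exists>b. (b, m) \<in> ?P \<and> c (b, m) \<noteq> 0)"
    obtain b0 where b0: "(b0, m0) \<in> ?P" "c (b0, m0) \<noteq> 0"
      using LeastI_ex[OF ex] unfolding m0_def by blast
    have low: "c (b, m) = 0" if "(b, m) \<in> ?P" "m < m0" for b m
      using not_less_Least[OF that(2)[unfolded m0_def]] that(1) by blast
    have b0_B: "b0 \<in> B" using b0 by (simp add: mem_orbit_index)
    \<comment> \<open>Factors \<open>T ^^ m0\<close> out of the relation by lowering every exponent
      by \<open>m0\<close>. The subtraction truncates for exponents below \<open>m0\<close>, but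
      there the coefficients vanish.\<close>
    define g where "g = (\<lambda>p. c p *s (T ^^ (snd p - m0)) (fst p))"
    define x where "x = sum g ?P"
    let ?R = "(B - {b0}) \<union> range T"
    have g: "(T ^^ m0) (g p) = c p *s orbit_vector p" if "p \<in> ?P" for p
    proof -
      obtain b m where p: "p = (b, m)" by force
      have "(T ^^ m0) (g p) = c p *s (T ^^ (m0 + (m - m0))) b"
        using linear_funpow[of m0]
        by (simp add: g_def p linear_iff_module_hom module_hom.scale funpow_add)
      moreover have "c p = 0" if "m < m0" using low that \<open>p \<in> ?P\<close> p by simp
      ultimately show ?thesis
        by (cases "m < m0") (simp_all add: p orbit_vector_def)
    qed
    have "(T ^^ m0) x = (\<Sum>p\<in>?P. (T ^^ m0) (g p))"
      using linear_funpow[of m0] by (simp add: x_def linear_iff_module_hom module_hom.sum)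
    also have "\<dots> = 0" using rel g by simp
    finally have height_x: "nil_height T x \<le> m0" by (simp add: funpow_eq_0_iff)
    \<comment> \<open>Terms with exponent below \<open>m0\<close> are zero, those at
      \<open>m0\<close> are multiples of other vectors of \<open>B\<close>, and those above lie in
      \<open>range T\<close>. Only the term of \<open>(b0, m0)\<close>, a nonzero multiple of
      \<open>b0\<close>, is left out.\<close>
    have "g p \<in> span ?R" if p: "p \<in> ?P - {(b0, m0)}" for p
    proof -
      obtain b m where bm: "p = (b, m)" by force
      consider "m < m0" | "m = m0" "b \<noteq> b0" | "m > m0" using p bm by force
      then show ?thesis
      proof cases
        case 1
        then show ?thesis using low p bm by (simp add: g_def span_zero)
      next
        case 2
        then have "b \<in> B - {b0}" using p bm by (auto simp: mem_orbit_index)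
        then show ?thesis using 2 by (auto simp: g_def bm intro: span_scale span_base)
      next
        case 3
        then obtain k where "m - m0 = Suc k" by (metis Suc_diff_Suc)
        then have "g p = c p *s T ((T ^^ k) b)" by (simp add: g_def bm)
        moreover have "T ((T ^^ k) b) \<in> span ?R" by (rule span_base) simp
        ultimately show ?thesis by (simp add: span_scale)
      qed
    qed
    then have "sum g (?P - {(b0, m0)}) \<in> span ?R" by (rule span_sum)
    moreover have "x - c (b0, m0) *s b0 = sum g (?P - {(b0, m0)})"
      using b0 fin by (simp add: x_def sum.remove g_def)
    ultimately have "is_q_basis scale T (insert x (B - {b0}))"
      by (intro is_q_basis_exchange[OF B b0_B b0(2)]) simp
    then have "weight T B \<le> weight T (insert x (B - {b0}))"
      using assms by (simp add: is_min_weight_q_basis_def)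
    \<comment> \<open>An inequality also covers the case that \<open>x\<close> coincides with a
      vector of \<open>B - {b0}\<close>.\<close>
    also have "\<dots> \<le> nil_height T x + weight T (B - {b0})"
      using fin by (cases "x \<in> B - {b0}") (auto simp: weight_def insert_absorb)
    \<comment> \<open>Strict because \<open>(b0, m0)\<close> is an index, so \<open>m0\<close> is
      below the height of \<open>b0\<close>, while the height of \<open>x\<close> is at most
      \<open>m0\<close>.\<close>
    also have "\<dots> < nil_height T b0 + weight T (B - {b0})"
      using height_x b0(1) by (auto simp: orbit_index_def)
    also have "\<dots> = weight T B"
      using fin b0_B by (simp add: weight_def sum.remove)
    finally show False by simp
  qed
  show "inj_on orbit_vector ?P" "independent (orbit T B)"
    using independent_family_imp_inj_independent[OF fin(2) indep] by (simp_all add: orbit_eq)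
qed

text \<open>The chains are the orbits of the single vectors of \<open>B\<close>. A vector common to
  two of them would come from two different pairs, against injectivity of
  \<open>orbit_vector\<close>.\<close>

lemma min_weight_imp_jordan_basis:
  assumes min: "is_min_weight_q_basis scale T B"
  shows "is_jordan_basis scale T (orbit T B)"
proof -
  have B: "is_q_basis scale T B" using min by (simp add: is_min_weight_q_basis_def)
  note inj = min_weight_orbit(1)[OF min]
  let ?C = "(\<lambda>b. orbit T {b}) ` B"
  have "is_basis scale (orbit T B)"
    using min_weight_orbit(2)[OF min] B by (simp add: is_basis_def span_orbit is_q_basis_iff)
  moreover have "is_chain T C" if "C \<in> ?C" for C
  proof -
    from that obtain b where "b \<in> B" "C = orbit T {b}" by blast
    moreover from this have "b \<noteq> 0" using zero_notin_q_basis[OF B] by blast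
    ultimately show ?thesis using is_chain_iff_orbit[OF T_0 nilpotent_T] by blast
  qed
  moreover have "disjoint ?C"
  proof (rule disjointI, rule ccontr)
    fix C D assume "C \<in> ?C" "D \<in> ?C" and ne: "C \<noteq> D" "C \<inter> D \<noteq> {}"
    then obtain b d where bd: "b \<in> B" "C = orbit T {b}" "d \<in> B" "D = orbit T {d}" by blast
    then obtain m n where mn: "(T ^^ m) b = (T ^^ n) d" "(T ^^ m) b \<noteq> 0"
      using ne by (force simp: orbit_def)
    then have "(b, m) = (d, n)"
      using bd by (intro inj_onD[OF inj]) (auto simp: mem_orbit_index orbit_vector_def)
    then show False using ne bd by simp
  qed
  moreover have "orbit T B = \<Union>?C" by (auto simp: orbit_def)
  ultimately show ?thesis unfolding is_jordan_basis_def by blast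
qed

section \<open>From Jordan bases to minimum weight\<close>

lemma orbit_vector_inj_single: "inj_on orbit_vector (orbit_index {b})"
proof -
  have less: False if "m < n" "(T ^^ m) b = (T ^^ n) b" "(T ^^ n) b \<noteq> 0" for m n
  proof -
    \<comment> \<open>The power \<open>T ^^ k\<close> just kills \<open>(T ^^ n) b\<close>:
      \<open>k + n\<close> is the height of \<open>b\<close>, and \<open>k + m\<close> is still
      below it.\<close>
    define k where "k = nil_height T b - n"
    have "(T ^^ (k + m)) b = (T ^^ (k + n)) b" using that by (simp add: funpow_add)
    moreover have "(T ^^ (k + m)) b \<noteq> 0" "(T ^^ (k + n)) b = 0"
      using that by (auto simp: k_def funpow_eq_0_iff)
    ultimately show False by simp
  qed
  show ?thesis
    by (rule inj_onI)
      (auto simp: orbit_vector_def mem_orbit_index, metis less linorder_neqE_nat)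
qed

text \<open>\<open>T\<close> sends an orbit vector to zero or to its successor, which has positive
  exponent and so by injectivity is never an element \<open>b\<close> of \<open>B\<close>. Hence
  \<open>range T\<close> lies in the span of the basis without \<open>b\<close>.\<close>

lemma independent_orbit_imp_q_basis:
  assumes basis: "is_basis scale (orbit T B)" and inj: "inj_on orbit_vector (orbit_index B)"
    and nz: "0 \<notin> B"
  shows "is_q_basis scale T B"
proof -
  let ?J = "orbit T B"
  have J: "independent ?J" "span ?J = UNIV" using basis by (auto simp: is_basis_def)
  have range: "range T = span (T ` ?J)"
    using linear_T J(2) by (simp add: linear_iff_module_hom module_hom.span_image)
  have B_J: "B \<subseteq> ?J" using nz by (force simp: orbit_def intro: exI[of _ 0])
  have "b \<notin> span ((B - {b}) \<union> range T)" if b: "b \<in> B" for b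
  proof -
    have "T y \<in> span (?J - {b})" if "y \<in> ?J" for y
    proof (cases "T y = 0")
      case True
      then show ?thesis by (simp add: span_zero)
    next
      case False
      from that obtain a m where a: "a \<in> B" "y = (T ^^ m) a" by (auto simp: orbit_def)
      have ne: "(T ^^ Suc m) a \<noteq> 0" using False a by simp
      have "b \<noteq> 0" using nz b by auto
      then have "T y \<noteq> b"
        using ne inj_onD[OF inj, of "(a, Suc m)" "(b, 0)"] a b
        by (auto simp: mem_orbit_index orbit_vector_def)
      moreover have "(T ^^ Suc m) a \<in> ?J" using ne a unfolding orbit_def by blast
      ultimately show ?thesis using a by (auto intro: span_base)
    qed
    then have "span (T ` ?J) \<subseteq> span (?J - {b})" by (intro span_minimal) auto
    then have "(B - {b}) \<union> range T \<subseteq> span (?J - {b})"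
      using B_J range by (auto intro: span_base)
    then have "span ((B - {b}) \<union> range T) \<subseteq> span (?J - {b})" by (simp add: span_minimal)
    then show ?thesis using J(1) b B_J by (auto simp: dependent_def)
  qed
  moreover have "span (B \<union> range T) = UNIV"
  proof -
    have "?J \<subseteq> B \<union> range T"
    proof
      fix y assume "y \<in> ?J"
      then obtain b m where "b \<in> B" "y = (T ^^ m) b" by (auto simp: orbit_def)
      then show "y \<in> B \<union> range T" by (cases m) auto
    qed
    then show ?thesis using J(2) span_mono by blast
  qed
  ultimately show ?thesis by (simp add: is_q_basis_iff)
qed

text \<open>The chain heads produce each vector of \<open>J\<close> from exactly one pair, so their
  weight is \<open>card J\<close>, the dimension, and the lower bound is attained.\<close>

lemma jordan_basis_imp_min_weight:
  assumes "is_jordan_basis scale T J"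
  shows "\<exists>B. is_min_weight_q_basis scale T B \<and> J = orbit T B"
proof -
  obtain \<C> where basis: "is_basis scale J" and disj: "disjoint \<C>" and J: "J = \<Union>\<C>"
    and "\<forall>C\<in>\<C>. is_chain T C"
    using assms by (auto simp: is_jordan_basis_def)
  then obtain f where f: "f C \<noteq> 0" "C = orbit T {f C}" if "C \<in> \<C>" for C
    using is_chain_iff_orbit[OF T_0 nilpotent_T] by metis
  define B where "B = f ` \<C>"
  have "orbit T B = (\<Union>C\<in>\<C>. orbit T {f C})" by (auto simp: orbit_def B_def)
  also have "\<dots> = J" unfolding J using f(2) by auto
  finally have orb: "orbit T B = J" .
  have inj: "inj_on orbit_vector (orbit_index B)"
  proof (rule inj_onI, clarify)
    fix b m d n
    assume *: "(b, m) \<in> orbit_index B" "(d, n) \<in> orbit_index B"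
      "orbit_vector (b, m) = orbit_vector (d, n)"
    obtain C D where CD: "C \<in> \<C>" "b = f C" "D \<in> \<C>" "d = f D"
      using * by (auto simp: mem_orbit_index B_def)
    have "(T ^^ m) b \<noteq> 0" "(T ^^ m) b = (T ^^ n) d"
      using * by (simp_all add: mem_orbit_index orbit_vector_def)
    then have "(T ^^ m) b \<in> orbit T {b}" "(T ^^ m) b \<in> orbit T {d}"
      unfolding orbit_def by (blast, metis (mono_tags, lifting) mem_Collect_eq singletonI)
    \<comment> \<open>Disjointness of the chains makes the two heads equal; the exponents then agree
      because the vectors within one orbit are distinct.\<close>
    then have "C \<inter> D \<noteq> {}" using f(2) CD by blast
    then have "C = D" using disj CD by (auto dest: disjointD)
    then have "b = d" using CD by simp
    then show "b = d \<and> m = n"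
      using inj_onD[OF orbit_vector_inj_single[of b] *(3)] *(1,2) by (auto simp: mem_orbit_index)
  qed
  have q: "is_q_basis scale T B"
    by (rule independent_orbit_imp_q_basis) (use basis inj f(1) in \<open>auto simp: orb, auto simp: B_def\<close>)
  have "weight T B = card J"
    using card_image[OF inj] card_orbit_index[OF finite_q_basis[OF q]] by (simp add: orb flip: orbit_eq)
  also have "\<dots> = dim UNIV"
    using basis by (intro dim_unique[symmetric]) (auto simp: is_basis_def)
  finally have "is_min_weight_q_basis scale T B"
    using q dim_le_weight by (simp add: is_min_weight_q_basis_def)
  then show ?thesis using orb by blast
qed

end

theorem proposition1p0p1:
  fixes scale :: "complex \<Rightarrow> 'v::ab_group_add \<Rightarrow> 'v"
    and T :: "'v \<Rightarrow> 'v"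
    and J :: "'v set"
  assumes "\<exists>Basis. finite_dimensional_vector_space scale Basis"
    and "Vector_Spaces.linear scale scale T"
    and "nilpotent_map T"
  shows "is_jordan_basis scale T J \<longleftrightarrow>
    (\<exists>B. is_min_weight_q_basis scale T B \<and> J = orbit T B)"
proof -
  obtain Basis where "finite_dimensional_vector_space scale Basis" using assms(1) by blast
  then interpret nilpotent_operator scale Basis T
    using assms(2,3) by (intro nilpotent_operator.intro nilpotent_operator_axioms.intro)
  show ?thesis using jordan_basis_imp_min_weight min_weight_imp_jordan_basis by blast
qed

end
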